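(* Let $U\in\mathbb{C}^{n\times n}$ be a unitary matrix and consider the transformation $h(G)=U^\dagger GU$ of $\mathbb{C}_h^{n\times n}$. Let $\mathcal{K}_0\subseteq\mathbb{C}_h^{n\times n}$ be a coherent set of strictly desirable gambles (SDG), let $\mathcal{K}_1=\{G\in\mathbb{C}_h^{n\times n}\mid U^\dagger GU\in\mathcal{K}_0\}$, and let $\mathcal{M}_0=(\mathcal{K}_0)^\bullet$. Then $$(\mathcal{K}_1)^\bullet=\left\{U\rho U^\dagger\mid\rho\in\mathcal{M}_0\right\}.$$
   Context: $\mathbb{C}_h^{n\times n}$ is the real vector space of $n\times n$ complex Hermitian matrices, with inner product $G\cdot R=\mathrm{Tr}(G^\dagger R)$. For $G\in\mathbb{C}_h^{n\times n}$: $G\gneq 0$ means $G$ is positive semi-definite and $G\ne 0$; $G>0$ means positive definite. $\mathcal{D}_h^{n\times n}$ is the set of density matrices (positive semi-definite Hermitian matrices with trace one). A set $\mathcal{K}\subseteq\mathbb{C}_h^{n\times n}$ is a coherent set of strictly desirable gambles (SDG) if: (S1) $\mathcal{K}$ is a non-pointed convex cone, i.e. closed under addition and under multiplication by reals $\nu>0$, and $0\notin\mathcal{K}$; (S2) every $G\gneq 0$ belongs to $\mathcal{K}$; (S3) if $G\in\mathcal{K}$ then either $G\gneq 0$ or $G-\Delta\in\mathcal{K}$ for some $\Delta\in\mathbb{C}_h^{n\times n}$ with $\Delta>0$. The dual (quantum credal set) of $\mathcal{K}$ is $\mathcal{K}^\bullet=\{\rho\in\mathcal{D}_h^{n\times n}\mid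 G\cdot\rho\ge 0\ \forall G\in\mathcal{K}\}$. *)

theory Defs
  imports "HOL-Analysis.Analysis"
begin

definition conj_transpose :: "complex^'n^'m \<Rightarrow> complex^'m^'n" where
  "conj_transpose A = (\<chi> i j. cnj (A $ j $ i))"

definition unitary_matrix :: "complex^'n^'n \<Rightarrow> bool" where
  "unitary_matrix U \<longleftrightarrow>
     conj_transpose U ** U = mat 1 \<and> U ** conj_transpose U = mat 1"

definition hermitian :: "complex^'n^'n \<Rightarrow> bool" where
  "hermitian A \<longleftrightarrow> conj_transpose A = A"

text \<open>Both forms below are real-valued on Hermitian matrices (lemmas
  \<open>trace_hermitian_in_Reals\<close> and \<open>quad_form_hermitian_in_Reals\<close>), so taking the real part
  only changes the type.\<close>

definition hs_inner :: "complex^'n^'n \<Rightarrow> complex^'n^'n \<Rightarrow> real" where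
  "hs_inner G R = Re (trace (conj_transpose G ** R))"

definition quad_form :: "complex^'n^'n \<Rightarrow> complex^'n \<Rightarrow> real" where
  "quad_form G x = Re (\<Sum>i\<in>UNIV. cnj (x $ i) * (G *v x) $ i)"

lemma trace_hermitian_in_Reals:
  fixes G R :: "complex^'n^'n"
  assumes "hermitian G" and "hermitian R"
  shows "trace (conj_transpose G ** R) \<in> \<real>"
proof -
  have G: "cnj (G $ i $ j) = G $ j $ i" for i j
    using assms(1) by (auto simp: hermitian_def conj_transpose_def vec_eq_iff)
  have R: "cnj (R $ i $ j) = R $ j $ i" for i j
    using assms(2) by (auto simp: hermitian_def conj_transpose_def vec_eq_iff)
  have tr: "trace (conj_transpose G ** R) = (\<Sum>i\<in>UNIV. \<Sum>k\<in>UNIV. G $ i $ k * R $ k $ i)"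
    by (simp add: trace_def matrix_matrix_mult_def conj_transpose_def G)
  have "cnj (trace (conj_transpose G ** R)) = (\<Sum>i\<in>UNIV. \<Sum>k\<in>UNIV. G $ k $ i * R $ i $ k)"
    by (simp add: tr G R)
  also have "\<dots> = (\<Sum>k\<in>UNIV. \<Sum>i\<in>UNIV. G $ k $ i * R $ i $ k)"
    by (rule sum.swap)
  finally show ?thesis
    by (simp add: tr Reals_cnj_iff)
qed

lemma quad_form_hermitian_in_Reals:
  fixes G :: "complex^'n^'n"
  assumes "hermitian G"
  shows "(\<Sum>i\<in>UNIV. cnj (x $ i) * (G *v x) $ i) \<in> \<real>"
proof -
  have G: "cnj (G $ i $ j) = G $ j $ i" for i j
    using assms by (auto simp: hermitian_def conj_transpose_def vec_eq_iff)
  have q: "(\<Sum>i\<in>UNIV. cnj (x $ i) * (G *v x) $ i) =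
      (\<Sum>i\<in>UNIV. \<Sum>j\<in>UNIV. cnj (x $ i) * G $ i $ j * x $ j)"
    by (simp add: matrix_vector_mult_def sum_distrib_left mult.assoc)
  have "cnj (\<Sum>i\<in>UNIV. cnj (x $ i) * (G *v x) $ i) =
      (\<Sum>i\<in>UNIV. \<Sum>j\<in>UNIV. cnj (x $ j) * G $ j $ i * x $ i)"
    by (simp add: q G mult_ac)
  also have "\<dots> = (\<Sum>j\<in>UNIV. \<Sum>i\<in>UNIV. cnj (x $ j) * G $ j $ i * x $ i)"
    by (rule sum.swap)
  finally show ?thesis
    by (simp add: q Reals_cnj_iff)
qed

definition positive_semidefinite :: "complex^'n^'n \<Rightarrow> bool" where
  "positive_semidefinite G \<longleftrightarrow> hermitian G \<and> (\<forall>x. quad_form G x \<ge> 0)"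

definition positive_definite :: "complex^'n^'n \<Rightarrow> bool" where
  "positive_definite G \<longleftrightarrow> hermitian G \<and> (\<forall>x. x \<noteq> 0 \<longrightarrow> quad_form G x > 0)"

definition psd_nonzero :: "complex^'n^'n \<Rightarrow> bool" where
  "psd_nonzero G \<longleftrightarrow> positive_semidefinite G \<and> G \<noteq> 0"

definition density_matrices :: "(complex^'n^'n) set" where
  "density_matrices = {\<rho>. positive_semidefinite \<rho> \<and> trace \<rho> = 1}"

text \<open>The cone condition is spelled out because the library's \<open>cone\<close> and \<open>convex_cone\<close>
  allow the scalar \<open>0\<close>, so that every nonempty cone contains the origin.\<close>

definition coherent_SDG :: "(complex^'n^'n) set \<Rightarrow> bool" where
  "coherent_SDG K \<longleftrightarrow>
     K \<subseteq> {G. hermitian G} \<and>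
     (\<forall>G\<in>K. \<forall>R\<in>K. G + R \<in> K) \<and> (\<forall>G\<in>K. \<forall>\<nu>::real. \<nu> > 0 \<longrightarrow> \<nu> *\<^sub>R G \<in> K) \<and> 0 \<notin> K \<and>
     (\<forall>G. psd_nonzero G \<longrightarrow> G \<in> K) \<and>
     (\<forall>G\<in>K. psd_nonzero G \<or> (\<exists>\<Delta>. positive_definite \<Delta> \<and> G - \<Delta> \<in> K))"

definition quantum_credal_set :: "(complex^'n^'n) set \<Rightarrow> (complex^'n^'n) set" where
  "quantum_credal_set K = {\<rho> \<in> density_matrices. \<forall>G\<in>K. hs_inner G \<rho> \<ge> 0}"

end

theory Submission
  imports Defs
begin

text \<open>For the trace inner product, the adjoint of \<open>h(G) = U\<dagger> G U\<close> is
  \<open>\<rho> \<mapsto> U \<rho> U\<dagger>\<close>, so pairing \<open>G\<close> with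
  \<open>U \<rho> U\<dagger>\<close> is the same as pairing \<open>h(G)\<close> with
  \<open>\<rho>\<close> (\<open>hs_inner_congruence_right\<close>). Since \<open>U\<close> is
  unitary, \<open>h\<close> maps \<open>K1\<close> bijectively onto \<open>K0\<close>, and the
  adjoint permutes the density matrices (\<open>density_matrices_unitary_conjugation\<close>). Hence
  the inequalities defining the dual of \<open>K1\<close> at \<open>U \<rho> U\<dagger>\<close> are
  exactly those defining the dual of \<open>K0\<close> at \<open>\<rho>\<close>.\<close>

lemma conj_transpose_mult:
  fixes A :: "complex^'n^'m" and B :: "complex^'k^'n"
  shows "conj_transpose (A ** B) = conj_transpose B ** conj_transpose A"
  by (simp add: conj_transpose_def matrix_matrix_mult_def vec_eq_iff mult.commute)

lemma conj_transpose_conj_transpose [simp]: "conj_transpose (conj_transpose A) = A"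
  by (simp add: conj_transpose_def vec_eq_iff)

lemma hermitian_congruence:
  assumes "hermitian G"
  shows "hermitian (A ** G ** conj_transpose A)"
  using assms by (simp add: hermitian_def conj_transpose_mult matrix_mul_assoc)

text \<open>The adjoint law for the standard Hermitian form on vectors. It lets a quadratic form
  absorb a congruence into its argument, which is why congruence preserves semidefiniteness.\<close>

lemma sum_cnj_matrix_vector_mult:
  fixes A :: "complex^'n^'m"
  shows "(\<Sum>i\<in>UNIV. cnj (x $ i) * (A *v y) $ i) =
    (\<Sum>j\<in>UNIV. cnj ((conj_transpose A *v x) $ j) * y $ j)"
proof -
  have "(\<Sum>i\<in>UNIV. cnj (x $ i) * (A *v y) $ i) =
      (\<Sum>i\<in>UNIV. \<Sum>j\<in>UNIV. cnj (x $ i) * A $ i $ j * y $ j)"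
    by (simp add: matrix_vector_mult_def sum_distrib_left mult.assoc)
  also have "\<dots> = (\<Sum>j\<in>UNIV. \<Sum>i\<in>UNIV. cnj (x $ i) * A $ i $ j * y $ j)"
    by (rule sum.swap)
  also have "\<dots> = (\<Sum>j\<in>UNIV. cnj ((conj_transpose A *v x) $ j) * y $ j)"
    by (simp add: matrix_vector_mult_def conj_transpose_def sum_distrib_left mult_ac)
  finally show ?thesis .
qed

lemma quad_form_congruence:
  "quad_form (A ** G ** conj_transpose A) x = quad_form G (conj_transpose A *v x)"
  by (simp add: quad_form_def sum_cnj_matrix_vector_mult[of x A]
      flip: matrix_vector_mul_assoc)

lemma positive_semidefinite_congruence:
  assumes "positive_semidefinite G"
  shows "positive_semidefinite (A ** G ** conj_transpose A)"
  using assms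
  by (simp add: positive_semidefinite_def hermitian_congruence quad_form_congruence)

text \<open>Cyclicity of the trace brings the two outer factors together, where they cancel.\<close>

lemma trace_unitary_conjugation:
  assumes "conj_transpose U ** U = mat 1"
  shows "trace (U ** G ** conj_transpose U) = trace G"
  using trace_mul_sym[of "U ** G" "conj_transpose U"] assms
  by (simp add: matrix_mul_assoc)

lemma density_matrices_unitary_conjugation:
  assumes "conj_transpose U ** U = mat 1" and "\<rho> \<in> density_matrices"
  shows "U ** \<rho> ** conj_transpose U \<in> density_matrices"
  using assms
  by (simp add: density_matrices_def positive_semidefinite_congruence trace_unitary_conjugation)

text \<open>Cyclicity carries the trailing \<open>conj_transpose A\<close> to the front, next to
  \<open>conj_transpose G ** A\<close>; the product of the three is the conjugate transpose of
  \<open>conj_transpose A ** G ** A\<close>.\<close>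

lemma hs_inner_congruence_right:
  "hs_inner G (A ** R ** conj_transpose A) = hs_inner (conj_transpose A ** G ** A) R"
  using trace_mul_sym[of "conj_transpose G ** A ** R" "conj_transpose A"]
  by (simp add: hs_inner_def conj_transpose_mult matrix_mul_assoc)

text \<open>Kept symmetric in \<open>U\<close> and \<open>V\<close> so that it serves conjugation by
  a unitary in either direction.\<close>

lemma unitary_conjugation_inverse:
  assumes "V ** U = mat 1" and "U ** V = mat 1"
  shows "U ** (V ** G ** U) ** V = G"
proof -
  have "U ** (V ** G ** U) ** V = (U ** V) ** G ** (U ** V)"
    by (simp only: matrix_mul_assoc)
  then show ?thesis
    using assms by simp
qed

theorem propositionA10:
  fixes U :: "complex^'n^'n" and K0 :: "(complex^'n^'n) set"
  assumes "unitary_matrix U" and "coherent_SDG K0"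
  shows "quantum_credal_set {G. hermitian G \<and> conj_transpose U ** G ** U \<in> K0} =
    {U ** \<rho> ** conj_transpose U |\<rho>. \<rho> \<in> quantum_credal_set K0}"
    (is "quantum_credal_set ?K1 = ?M1")
proof
  have U: "conj_transpose U ** U = mat 1" "U ** conj_transpose U = mat 1"
    using assms(1) by (auto simp: unitary_matrix_def)
  show "quantum_credal_set ?K1 \<subseteq> ?M1"
  proof
    fix \<sigma> assume \<sigma>: "\<sigma> \<in> quantum_credal_set ?K1"
    \<comment> \<open>The only candidate, found by solving
      \<open>\<sigma> = U ** \<rho> ** conj_transpose U\<close> for \<open>\<rho>\<close>. It is a
      density matrix because \<open>conj_transpose U\<close> is unitary too.\<close>
    let ?\<rho> = "conj_transpose U ** \<sigma> ** U"
    have "?\<rho> \<in> density_matrices"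
      using density_matrices_unitary_conjugation[of "conj_transpose U" \<sigma>] \<sigma> U
      by (simp add: quantum_credal_set_def)
    moreover have "hs_inner G ?\<rho> \<ge> 0" if "G \<in> K0" for G
    proof -
      have "hermitian G"
        using assms(2) that by (auto simp: coherent_SDG_def)
      \<comment> \<open>The preimage of \<open>G\<close> under \<open>h\<close>: testing
        \<open>\<sigma>\<close> against it amounts to testing \<open>?\<rho>\<close> against
        \<open>G\<close>.\<close>
      then have "U ** G ** conj_transpose U \<in> ?K1"
        using that unitary_conjugation_inverse[of U "conj_transpose U" G] U
        by (simp add: hermitian_congruence)
      then have "hs_inner (U ** G ** conj_transpose U) \<sigma> \<ge> 0"
        using \<sigma> unfolding quantum_credal_set_def by blast
      then show ?thesis
        using hs_inner_congruence_right[of G "conj_transpose U" \<sigma>] by simp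
    qed
    ultimately have "?\<rho> \<in> quantum_credal_set K0"
      by (simp add: quantum_credal_set_def)
    moreover have "\<sigma> = U ** ?\<rho> ** conj_transpose U"
      using unitary_conjugation_inverse[of "conj_transpose U" U \<sigma>] U by simp
    ultimately show "\<sigma> \<in> ?M1"
      by blast
  qed
  \<comment> \<open>Here adjointness applies directly, since each \<open>G\<close> in
    \<open>?K1\<close> has \<open>conj_transpose U ** G ** U\<close> in \<open>K0\<close>.\<close>
  show "?M1 \<subseteq> quantum_credal_set ?K1"
    using density_matrices_unitary_conjugation[OF U(1)]
    by (auto simp: quantum_credal_set_def hs_inner_congruence_right)
qed

end
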